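(* Let $T=\{1,\dots,m\}$, let $a_t\in\mathbb{R}^n$ ($t\in T$) and $u\in\mathbb{R}^n$ be fixed, and for $b=(b_t)_{t\in T}\in\mathbb{R}^T$ let $\mathcal{F}(b):=\{x\in\mathbb{R}^n:\langle a_t,x\rangle\le b_t,\ t\in T\}$. Given any $b\in\mathbb{R}^T$, the set $\mathcal{F}(b)+\mathrm{span}\{u\}$ is equal to the set of all $x\in\mathbb{R}^n$ such that $$\langle a_t,x\rangle\le b_t\ \text{ for all }t\in T\text{ with }\langle a_t,u\rangle=0,$$ and $$\langle a_{(t,s)},x\rangle\le b_{(t,s)}\ \text{ for all }t,s\in T\text{ with }\langle a_t,u\rangle<0\text{ and }\langle a_s,u\rangle>0,$$ where $a_{(t,s)}:=\langle a_s,u\rangle a_t-\langle a_t,u\rangle a_s$ and $b_{(t,s)}:=\langle a_s,u\rangle b_t-\langle a_t,u\rangle b_s$.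
   Context: $\mathrm{span}\{u\}=\{\mu u:\mu\in\mathbb{R}\}$; sums of sets are Minkowski sums. If there are no inequalities in the system, its solution set is $\mathbb{R}^n$. *)

theory Defs
  imports "HOL-Analysis.Analysis" "HOL-Library.Set_Algebras"
begin

definition feasible_set ::
    "nat set \<Rightarrow> (nat \<Rightarrow> real ^ 'n) \<Rightarrow> (nat \<Rightarrow> real) \<Rightarrow> (real ^ 'n) set"
  where "feasible_set T a b = {x. \<forall>t\<in>T. a t \<bullet> x \<le> b t}"

definition a_comb ::
    "(nat \<Rightarrow> real ^ 'n) \<Rightarrow> real ^ 'n \<Rightarrow> nat \<Rightarrow> nat \<Rightarrow> real ^ 'n"
  where "a_comb a u t s = (a s \<bullet> u) *\<^sub>R a t - (a t \<bullet> u) *\<^sub>R a s"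

definition b_comb ::
    "(nat \<Rightarrow> real ^ 'n) \<Rightarrow> real ^ 'n \<Rightarrow> (nat \<Rightarrow> real) \<Rightarrow> nat \<Rightarrow> nat \<Rightarrow> real"
  where "b_comb a u b t s = (a s \<bullet> u) * b t - (a t \<bullet> u) * b s"

end

theory Submission
  imports Defs
begin

text \<open>
  This is one step of Fourier--Motzkin elimination, performed along the direction \<open>u\<close>. A point
  \<open>x\<close> lies in \<open>feasible_set T a b + span {u}\<close> exactly when the line through \<open>x\<close> with direction
  \<open>u\<close> meets the feasible set, that is, when some real \<open>r\<close> satisfies the one-variable system
  \<open>(a t \<bullet> u) * r \<le> b t - a t \<bullet> x\<close> for all \<open>t \<in> T\<close>.

  The indices with \<open>a t \<bullet> u = 0\<close> put a condition on \<open>x\<close> alone. Those with \<open>a t \<bullet> u < 0\<close> bound \<open>r\<close>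
  from below and those with \<open>a t \<bullet> u > 0\<close> bound it from above, each by the quotient
  \<open>(b t - a t \<bullet> x) / (a t \<bullet> u)\<close>. Finitely many lower and upper bounds are compatible as soon as
  they are compatible in pairs (\<open>finite_sets_separated\<close>); clearing denominators in these pairwise
  comparisons (\<open>solvable_one_variable_system_iff\<close>) produces the inequalities with coefficients
  \<open>a_comb\<close> and \<open>b_comb\<close>.
\<close>

text \<open>The largest lower bound separates, or, if there are no lower bounds, the smallest upper
  bound; finiteness provides both, while either set may be empty.\<close>

lemma finite_sets_separated:
  fixes L U :: "'a::linorder set"
  assumes "finite L" "finite U" and le: "\<And>l v. l \<in> L \<Longrightarrow> v \<in> U \<Longrightarrow> l \<le> v"
  shows "\<exists>r. (\<forall>l\<in>L. l \<le> r) \<and> (\<forall>v\<in>U. r \<le> v)"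
proof (cases "L = {}")
  case True
  then show ?thesis
    using \<open>finite U\<close> Min_le by blast
next
  case False
  then have "Max L \<in> L"
    using \<open>finite L\<close> by simp
  then show ?thesis
    using \<open>finite L\<close> Max_ge le by blast
qed

text \<open>In the cross-multiplied form below, necessity comes from adding the inequality of a lower
  bound and that of an upper bound, scaled by positive factors that cancel \<open>r\<close>.\<close>

lemma solvable_one_variable_system_iff:
  fixes p q :: "'i \<Rightarrow> 'a::linordered_field"
  assumes "finite I"
  shows "(\<exists>r. \<forall>i\<in>I. p i * r \<le> q i) \<longleftrightarrow>
    (\<forall>i\<in>I. p i = 0 \<longrightarrow> 0 \<le> q i) \<and>
    (\<forall>i\<in>I. \<forall>j\<in>I. p i < 0 \<and> 0 < p j \<longrightarrow> 0 \<le> p j * q i - p i * q j)"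
    (is "?solvable \<longleftrightarrow> ?zero \<and> ?cross")
proof
  assume ?solvable
  then obtain r where r: "\<And>i. i \<in> I \<Longrightarrow> p i * r \<le> q i"
    by blast
  have "0 \<le> p j * q i - p i * q j" if "i \<in> I" "j \<in> I" "p i < 0" "0 < p j" for i j
  proof -
    have "p j * (p i * r) \<le> p j * q i"
      using r that by (intro mult_left_mono) auto
    moreover have "p i * q j \<le> p i * (p j * r)"
      using r that by (intro mult_left_mono_neg) auto
    ultimately show ?thesis
      by (simp add: mult.left_commute)
  qed
  moreover have ?zero
    using r by force
  ultimately show "?zero \<and> ?cross"
    by blast
next
  assume hyps: "?zero \<and> ?cross"
  define L where "L = (\<lambda>i. q i / p i) ` {i\<in>I. p i < 0}"
  define U where "U = (\<lambda>i. q i / p i) ` {i\<in>I. 0 < p i}"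
  have "l \<le> v" if "l \<in> L" "v \<in> U" for l v
  proof -
    obtain i j where i: "i \<in> I" "p i < 0" "l = q i / p i" and j: "j \<in> I" "0 < p j" "v = q j / p j"
      using \<open>l \<in> L\<close> \<open>v \<in> U\<close> unfolding L_def U_def by blast
    then have "0 \<le> p j * q i - p i * q j"
      using hyps by blast
    then show ?thesis
      using i j by (simp add: neg_divide_le_eq pos_divide_le_eq mult.commute)
  qed
  moreover have "finite L" "finite U"
    using \<open>finite I\<close> by (auto simp: L_def U_def)
  ultimately obtain r where r: "\<And>l. l \<in> L \<Longrightarrow> l \<le> r" "\<And>v. v \<in> U \<Longrightarrow> r \<le> v"
    using finite_sets_separated by metis
  have "p i * r \<le> q i" if "i \<in> I" for i
  proof (cases "p i" "0::'a" rule: linorder_cases)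
    case less
    then have "q i / p i \<le> r"
      using r(1) \<open>i \<in> I\<close> by (auto simp: L_def)
    then show ?thesis
      using less by (simp add: field_simps)
  next
    case equal
    then show ?thesis
      using hyps \<open>i \<in> I\<close> by simp
  next
    case greater
    then have "r \<le> q i / p i"
      using r(2) \<open>i \<in> I\<close> by (auto simp: U_def)
    then show ?thesis
      using greater by (simp add: field_simps)
  qed
  then show ?solvable
    by blast
qed

lemma mem_plus_span_singleton_iff:
  fixes S :: "'a::real_vector set"
  shows "x \<in> S + span {u} \<longleftrightarrow> (\<exists>r. x + r *\<^sub>R u \<in> S)"
proof
  assume "x \<in> S + span {u}"
  then obtain y k where "y \<in> S" "x = y + k *\<^sub>R u"
    by (auto simp: set_plus_def span_singleton)
  then have "x + (- k) *\<^sub>R u \<in> S"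
    by simp
  then show "\<exists>r. x + r *\<^sub>R u \<in> S" ..
next
  assume "\<exists>r. x + r *\<^sub>R u \<in> S"
  then obtain r where "x + r *\<^sub>R u \<in> S" ..
  moreover have "(- r) *\<^sub>R u \<in> span {u}"
    by (intro span_scale span_base) simp
  ultimately have "(x + r *\<^sub>R u) + (- r) *\<^sub>R u \<in> S + span {u}"
    by (rule set_plus_intro)
  then show "x \<in> S + span {u}"
    by simp
qed

theorem theorem6:
  fixes m :: nat and T :: "nat set"
    and a :: "nat \<Rightarrow> real ^ 'n" and u :: "real ^ 'n"
    and b :: "nat \<Rightarrow> real"
  assumes "T = {1..m}"
  shows "feasible_set T a b + span {u} =
    {x. (\<forall>t\<in>T. a t \<bullet> u = 0 \<longrightarrow> a t \<bullet> x \<le> b t) \<and>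
        (\<forall>t\<in>T. \<forall>s\<in>T. a t \<bullet> u < 0 \<and> a s \<bullet> u > 0 \<longrightarrow>
           a_comb a u t s \<bullet> x \<le> b_comb a u b t s)}"
proof (rule set_eqI)
  fix x
  have "finite T"
    using assms by simp
  have comb: "a_comb a u t s \<bullet> x \<le> b_comb a u b t s \<longleftrightarrow>
      0 \<le> (a s \<bullet> u) * (b t - a t \<bullet> x) - (a t \<bullet> u) * (b s - a s \<bullet> x)" for t s
    by (auto simp: a_comb_def b_comb_def inner_diff_left algebra_simps)
  have "x \<in> feasible_set T a b + span {u} \<longleftrightarrow>
      (\<exists>r. \<forall>t\<in>T. (a t \<bullet> u) * r \<le> b t - a t \<bullet> x)"
    unfolding mem_plus_span_singleton_iff feasible_set_def
    by (simp add: inner_add_right algebra_simps)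
  also have "\<dots> \<longleftrightarrow> x \<in> {x. (\<forall>t\<in>T. a t \<bullet> u = 0 \<longrightarrow> a t \<bullet> x \<le> b t) \<and>
        (\<forall>t\<in>T. \<forall>s\<in>T. a t \<bullet> u < 0 \<and> a s \<bullet> u > 0 \<longrightarrow>
           a_comb a u t s \<bullet> x \<le> b_comb a u b t s)}"
    unfolding solvable_one_variable_system_iff[OF \<open>finite T\<close>] by (simp add: comb)
  finally show "x \<in> feasible_set T a b + span {u} \<longleftrightarrow>
      x \<in> {x. (\<forall>t\<in>T. a t \<bullet> u = 0 \<longrightarrow> a t \<bullet> x \<le> b t) \<and>
        (\<forall>t\<in>T. \<forall>s\<in>T. a t \<bullet> u < 0 \<and> a s \<bullet> u > 0 \<longrightarrow>
           a_comb a u t s \<bullet> x \<le> b_comb a u b t s)}" .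
qed

end
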